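(* Let $d\ge1$ and $r\ge2$ be integers. For all Borel subsets $A_1,\dots,A_r\subset[0,1]^d$, the set $\square_{i=1}^rA_i$ is Lebesgue measurable and $$\lambda_d\Big(\square_{i=1}^rA_i\Big)\le\prod_{i=1}^r m_d(A_i).$$ For all Lebesgue measurable subsets $A_1,\dots,A_r\subset[0,1]^d$, there exists a Borel set $D\subset[0,1]^d$ with $\square_{i=1}^rA_i\subset D$ and $m_d(D)\le\prod_{i=1}^r\lambda_d(A_i)$.
   Context: Write $[d]=\{1,\dots,d\}$ and $S=[0,1]$. For $\omega\in S^d$ and $K\subset[d]$, let $\mathrm{Cyl}(K,\omega)=\{\overline\omega\in S^d:\overline\omega_i=\omega_i\text{ for all }i\in K\}$. For $A\subset S^d$ let $[A]_K=\{\omega\in S^d:\mathrm{Cyl}(K,\omega)\subset A\}$. The simultaneous $r$-fold BKR operator is defined, for $A_1,\dots,A_r\subset S^d$, by $\square_{i=1}^rA_i=\bigcup[A_1]_{J_1}\cap\cdots\cap[A_r]_{J_r}$, the union being over all $r$-tuples of pairwise disjoint (possibly empty) subsets $J_1,\dots,J_r$ of $[d]$. $m_d$ denotes Lebesgue measure on the Borel sigma-algebra of $[0,1]^d$, and $\lambda_d$ denotes its completion, i.e. Lebesgue measure on the Lebesgue measurable subsets of $[0,1]^d$. *)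

theory Defs
  imports "HOL-Analysis.Analysis"
begin

text \<open>Coordinates are indexed by an arbitrary finite type \<open>'n\<close> instead of \<open>{1..d}\<close>, with
  \<open>d = CARD('n) \<ge> 1\<close>.\<close>

definition unit_cube :: "(real^'n) set" where
  "unit_cube = {x. \<forall>i. x $ i \<in> {0..1}}"

definition cyl :: "'n set \<Rightarrow> real^'n \<Rightarrow> (real^'n) set" where
  "cyl K x = {y \<in> unit_cube. \<forall>i\<in>K. y $ i = x $ i}"

definition cyl_interior :: "'n set \<Rightarrow> (real^'n) set \<Rightarrow> (real^'n) set" where
  "cyl_interior K A = {x \<in> unit_cube. cyl K x \<subseteq> A}"

text \<open>The \<open>r\<close>-tuples \<open>(A\<^sub>1, \<dots>, A\<^sub>r)\<close> and \<open>(J\<^sub>1, \<dots>, J\<^sub>r)\<close> are functions on \<open>nat\<close>, of which only the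
  values on \<open>{1..r}\<close> matter. The predicate \<open>disjoint_family_on\<close> allows several of the \<open>J\<^sub>i\<close> to be
  empty. The operator is only meaningful for \<open>r \<ge> 1\<close>.\<close>

definition bkr_box :: "nat \<Rightarrow> (nat \<Rightarrow> (real^'n) set) \<Rightarrow> (real^'n) set" where
  "bkr_box r A =
    (\<Union>J\<in>{J. disjoint_family_on J {1..r}}. \<Inter>i\<in>{1..r}. cyl_interior (J i) (A i))"

definition cube_borel_measure :: "(real^'n) measure" where
  "cube_borel_measure = restrict_space lborel unit_cube"

definition cube_lebesgue_measure :: "(real^'n) measure" where
  "cube_lebesgue_measure = completion cube_borel_measure"

lemma unit_cube_eq_cbox: "unit_cube = cbox 0 (1 :: real^'n)"
  by (auto simp: unit_cube_def mem_box_cart)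

lemma sets_cube_borel_measure:
  "A \<in> sets cube_borel_measure \<longleftrightarrow> A \<in> sets borel \<and> A \<subseteq> unit_cube"
  unfolding cube_borel_measure_def
  by (subst sets_restrict_space_iff) (auto simp: unit_cube_eq_cbox)

lemma emeasure_cube_borel_measure:
  "A \<subseteq> unit_cube \<Longrightarrow> emeasure cube_borel_measure A = emeasure lborel A"
  unfolding cube_borel_measure_def
  by (rule emeasure_restrict_space) (auto simp: unit_cube_eq_cbox)

lemma null_sets_cube_borel_measure:
  "N \<in> null_sets cube_borel_measure \<longleftrightarrow> N \<in> null_sets lborel \<and> N \<subseteq> unit_cube"
  unfolding cube_borel_measure_def
  by (subst null_sets_restrict_space) (auto simp: unit_cube_eq_cbox)

lemma sets_cube_lebesgue_measure:
  "A \<in> sets cube_lebesgue_measure \<longleftrightarrow> A \<in> sets lebesgue \<and> A \<subseteq> unit_cube"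
proof
  assume "A \<in> sets cube_lebesgue_measure"
  then obtain S N N' where *: "A = S \<union> N" "N \<subseteq> N'" "N' \<in> null_sets cube_borel_measure"
    "S \<in> sets cube_borel_measure"
    unfolding cube_lebesgue_measure_def by (auto elim: sets_completionE)
  then show "A \<in> sets lebesgue \<and> A \<subseteq> unit_cube"
    by (auto simp: null_sets_cube_borel_measure sets_cube_borel_measure
        intro!: sets_completionI[of _ S N N' lborel])
next
  assume A: "A \<in> sets lebesgue \<and> A \<subseteq> unit_cube"
  then obtain S N N' where *: "A = S \<union> N" "N \<subseteq> N'" "N' \<in> null_sets lborel" "S \<in> sets lborel"
    by (auto elim: sets_completionE)
  have "N' \<inter> unit_cube \<in> null_sets lborel"
    using *(3) by (rule null_set_Int2) (auto simp: unit_cube_eq_cbox)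
  with * A show "A \<in> sets cube_lebesgue_measure"
    unfolding cube_lebesgue_measure_def
    by (intro sets_completionI[of _ S N "N' \<inter> unit_cube"])
      (auto simp: null_sets_cube_borel_measure sets_cube_borel_measure)
qed

end

theory Submission
  imports Defs
begin

text \<open>Reimer's combinatorial theorem bounds the number of points of \<open>A \<box> B\<close> in the discrete cube
  \<open>{0,1}\<^sup>d\<close> by the number of points of \<open>A\<close> whose antipode lies in \<open>B\<close>. Apply it to the \<open>2\<^sup>d\<close> points that
  take each coordinate from one of two independent uniform samples \<open>x, y \<in> [0,1]\<^sup>d\<close>. Such a mixture
  of \<open>x\<close> and \<open>y\<close> and its antipode are again independent and uniform, so taking expectations
  gives \<open>2\<^sup>d \<lambda>(A \<box> B) \<le> 2\<^sup>d \<lambda>(A) \<lambda>(B)\<close> exactly, with no discretisation of \<open>[0,1]\<close>.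

  The set \<open>[A]\<^sub>K\<close> is the complement of a projection of a Borel set, hence of an analytic set, and
  analytic sets are Lebesgue measurable. More than two sets are handled by induction on \<open>r\<close>, replacing
  the box of the first \<open>r\<close> sets by a Borel hull of the same measure.\<close>

section \<open>Reimer's theorem on the discrete cube\<close>

lemma prod_sum_UNIV:
  fixes f :: "'a::finite \<Rightarrow> 'b::finite \<Rightarrow> 'c::comm_semiring_1"
  shows "(\<Prod>i\<in>UNIV. \<Sum>t\<in>UNIV. f i t) = (\<Sum>g\<in>UNIV. \<Prod>i\<in>UNIV. f i (g i))"
  by (subst prod_sum_PiE) (auto simp: PiE_UNIV_domain)

text \<open>Gaussian elimination without division, so that the solution stays integral:
  cross-multiplying with the pivot \<open>a z p\<close> eliminates the unknown \<open>p\<close> from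
  the other equations.\<close>

lemma homogeneous_system_nontrivial:
  fixes a :: "'z \<Rightarrow> 'c \<Rightarrow> int"
  assumes "finite Z" "finite C" "card Z < card C"
  shows "\<exists>c. (\<exists>x\<in>C. c x \<noteq> 0) \<and> (\<forall>z\<in>Z. (\<Sum>x\<in>C. c x * a z x) = 0)"
  using assms
proof (induction arbitrary: C a rule: finite_induct)
  case empty
  then show ?case by (intro exI[of _ "\<lambda>_. 1"]) (auto simp: card_gt_0_iff)
next
  case (insert z Z)
  show ?case
  proof (cases "\<forall>x\<in>C. a z x = 0")
    case True
    with insert.IH[of C a] insert.prems insert.hyps show ?thesis by auto
  next
    case False
    then obtain p where p: "p \<in> C" "a z p \<noteq> 0" by auto
    define D where "D = C - {p}"
    have D: "finite D" "card Z < card D" "p \<notin> D" "C = insert p D"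
      using insert p by (auto simp: D_def)
    define b where "b = (\<lambda>y x. a z p * a y x - a z x * a y p)"
    obtain d where d: "\<exists>x\<in>D. d x \<noteq> 0" "\<forall>y\<in>Z. (\<Sum>x\<in>D. d x * b y x) = 0"
      using insert.IH[OF D(1,2), of b] by auto
    define c where "c = (\<lambda>x. if x = p then - (\<Sum>x\<in>D. d x * a z x) else a z p * d x)"
    have sumC: "(\<Sum>x\<in>C. c x * a y x) =
        a z p * (\<Sum>x\<in>D. d x * a y x) - (\<Sum>x\<in>D. d x * a z x) * a y p" for y
    proof -
      have "(\<Sum>x\<in>D. c x * a y x) = (\<Sum>x\<in>D. a z p * (d x * a y x))"
        using D(3) by (intro sum.cong) (auto simp: c_def)
      then show ?thesis
        using D by (simp add: c_def sum_distrib_left)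
    qed
    have "(\<Sum>x\<in>C. c x * a y x) = 0" if "y \<in> insert z Z" for y
    proof (cases "y = z")
      case False
      with that have "(\<Sum>x\<in>D. d x * b y x) = 0" using d by auto
      moreover have "(\<Sum>x\<in>D. d x * b y x) =
          a z p * (\<Sum>x\<in>D. d x * a y x) - (\<Sum>x\<in>D. d x * a z x) * a y p"
        by (simp add: b_def sum_distrib_left sum_distrib_right algebra_simps sum_subtractf)
      ultimately show ?thesis using sumC by simp
    qed (simp add: sumC)
    moreover have "\<exists>x\<in>C. c x \<noteq> 0"
      using d(1) p D by (auto simp: c_def)
    ultimately show ?thesis by blast
  qed
qed

lemma power_two_dvd_imp_zero:
  fixes n :: int
  assumes "\<And>k. 2 ^ k dvd n"
  shows "n = 0"
proof (rule ccontr)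
  assume "n \<noteq> 0"
  have "(2::int) ^ nat \<bar>n\<bar> \<le> \<bar>n\<bar>"
    using assms[of "nat \<bar>n\<bar>"] \<open>n \<noteq> 0\<close> by (metis abs_dvd_iff dvd_abs_iff zdvd_imp_le zero_less_abs_iff)
  moreover have "\<bar>n\<bar> < 2 ^ nat \<bar>n\<bar>"
    by (metis abs_ge_zero nat_0_le of_nat_less_two_power)
  ultimately show False by simp
qed

text \<open>Descent on powers of 2: after dividing \<open>2 ^ k\<close> out of all coefficients, the
  relation modulo 2 has the identity matrix and makes every quotient even.\<close>

lemma independent_if_identity_mod_2:
  fixes w :: "'c \<Rightarrow> 'c \<Rightarrow> int"
  assumes fin: "finite C"
    and diag: "\<And>x. x \<in> C \<Longrightarrow> odd (w x x)"
    and off: "\<And>x y. x \<in> C \<Longrightarrow> y \<in> C \<Longrightarrow> x \<noteq> y \<Longrightarrow> even (w x y)"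
    and zero: "\<And>y. y \<in> C \<Longrightarrow> (\<Sum>x\<in>C. c x * w x y) = 0"
    and "x \<in> C"
  shows "c x = 0"
proof -
  have "\<forall>x\<in>C. 2 ^ k dvd c x" for k
  proof (induction k)
    case (Suc k)
    then obtain d where d: "\<And>x. x \<in> C \<Longrightarrow> c x = 2 ^ k * d x"
      by (auto simp: dvd_def) metis
    have "even (d y)" if y: "y \<in> C" for y
    proof -
      have "2 ^ k * (\<Sum>x\<in>C. d x * w x y) = (\<Sum>x\<in>C. c x * w x y)"
        by (auto simp: d sum_distrib_left algebra_simps intro!: sum.cong)
      then have "(\<Sum>x\<in>C. d x * w x y) = 0" using zero[OF y] by simp
      then have "d y * w y y + (\<Sum>x\<in>C - {y}. d x * w x y) = 0"
        using y fin by (simp add: sum.remove)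
      moreover have "even (\<Sum>x\<in>C - {y}. d x * w x y)"
        using off y by (intro dvd_sum) auto
      ultimately have "even (d y * w y y)"
        by (metis dvd_0_right dvd_add_left_iff)
      with diag[OF y] show ?thesis by simp
    qed
    then show ?case by (auto simp: d)
  qed simp
  then show ?thesis using \<open>x \<in> C\<close> by (intro power_two_dvd_imp_zero) auto
qed

text \<open>The Gram matrix \<open>((2, -1), (-1, 2))\<close> is positive definite, being the form
  \<open>a\<^sup>2 + b\<^sup>2 + (a - b)\<^sup>2\<close>; the three squares are the values of the index \<open>k\<close> in \<open>gram_factor\<close>.\<close>

definition gram :: "bool \<Rightarrow> bool \<Rightarrow> int" where
  "gram s t = (if s = t then 2 else - 1)"

definition gram_factor :: "bool option \<Rightarrow> bool \<Rightarrow> int" where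
  "gram_factor k s =
    (case k of None \<Rightarrow> if s then 1 else - 1 | Some b \<Rightarrow> if s = b then 1 else 0)"

lemma gram_eq: "gram s t = (\<Sum>k\<in>UNIV. gram_factor k s * gram_factor k t)"
  by (cases s; cases t) (simp_all add: gram_def gram_factor_def UNIV_option_conv UNIV_bool)

text \<open>The factorisation of \<open>gram\<close> tensorises, so the form is a sum of squares of
  linear forms in \<open>f\<close>, one for each \<open>k\<close>, and all of them vanish.\<close>

lemma tensor_gram_positive_definite:
  fixes f :: "('n::finite \<Rightarrow> bool) \<Rightarrow> int"
  assumes "(\<Sum>y\<in>UNIV. \<Sum>z\<in>UNIV. f y * f z * (\<Prod>i\<in>UNIV. gram (y i) (z i))) = 0"
  shows "f x = 0"
proof -
  define L :: "('n \<Rightarrow> bool option) \<Rightarrow> ('n \<Rightarrow> bool) \<Rightarrow> int" where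
    "L k y = (\<Prod>i\<in>UNIV. gram_factor (k i) (y i))" for k y
  have "(\<Prod>i\<in>UNIV. gram (y i) (z i)) = (\<Sum>k\<in>UNIV. L k y * L k z)" for y z :: "'n \<Rightarrow> bool"
    by (simp add: gram_eq prod_sum_UNIV L_def prod.distrib)
  then have "0 = (\<Sum>y\<in>UNIV. \<Sum>z\<in>UNIV. \<Sum>k\<in>UNIV. (f y * L k y) * (f z * L k z))"
    using assms by (simp add: sum_distrib_left algebra_simps)
  also have "\<dots> = (\<Sum>y\<in>UNIV. \<Sum>k\<in>UNIV. \<Sum>z\<in>UNIV. (f y * L k y) * (f z * L k z))"
    by (intro sum.cong refl sum.swap)
  also have "\<dots> = (\<Sum>k\<in>UNIV. \<Sum>y\<in>UNIV. \<Sum>z\<in>UNIV. (f y * L k y) * (f z * L k z))"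
    by (rule sum.swap)
  also have "\<dots> = (\<Sum>k\<in>UNIV. (\<Sum>y\<in>UNIV. f y * L k y)\<^sup>2)"
    by (simp add: power2_eq_square sum_product)
  finally have "\<forall>k\<in>UNIV. (\<Sum>y\<in>UNIV. f y * L k y)\<^sup>2 = 0"
    by (subst (asm) eq_commute, subst (asm) sum_nonneg_eq_0_iff) auto
  \<comment> \<open>At this index each factor of \<open>L\<close> is the indicator of
    \<open>y i = x i\<close>, so the linear form reads off \<open>f x\<close>.\<close>
  then have "(\<Sum>y\<in>UNIV. f y * L (\<lambda>i. Some (x i)) y) = 0" by simp
  moreover have "L (\<lambda>i. Some (x i)) y = (if y = x then 1 else 0)" for y
    by (auto simp: L_def gram_factor_def fun_eq_iff intro!: prod.neutral)
  ultimately show ?thesis by (simp add: if_distrib cong: if_cong)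
qed

text \<open>The tensor \<open>w x\<close> with these factors is supported on the subcube of \<open>x\<close> with coordinates in \<open>J x\<close>
  fixed, and it is the unit vector at \<open>x\<close> modulo 2. The value 2 off the diagonal is chosen to make the
  image of \<open>w x\<close> under the tensor power of \<open>gram\<close> supported on the antipode of the subcube with the
  coordinates outside \<open>J x\<close> fixed.\<close>

definition wing_factor :: "bool \<Rightarrow> bool \<Rightarrow> bool \<Rightarrow> int" where
  "wing_factor in_J s t = (if s = t then 1 else if in_J then 0 else 2)"

lemma gram_wing_factor:
  "(\<Sum>t\<in>UNIV. wing_factor False s t * gram t s) = 0"
  by (cases s; simp add: UNIV_bool wing_factor_def gram_def)

theorem reimer_cube:
  fixes A B C :: "('n::finite \<Rightarrow> bool) set" and J :: "('n \<Rightarrow> bool) \<Rightarrow> 'n set"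
  assumes A: "\<And>x y. x \<in> C \<Longrightarrow> (\<And>i. i \<in> J x \<Longrightarrow> y i = x i) \<Longrightarrow> y \<in> A"
    and B: "\<And>x y. x \<in> C \<Longrightarrow> (\<And>i. i \<notin> J x \<Longrightarrow> y i = x i) \<Longrightarrow> y \<in> B"
  shows "card C \<le> card {y \<in> A. (\<lambda>i. \<not> y i) \<in> B}"
proof (rule ccontr)
  \<comment> \<open>If \<open>C\<close> has more points than \<open>Z\<close>, some nontrivial combination \<open>f\<close> of the \<open>w x\<close> vanishes on \<open>Z\<close>.
    Its image under the Gram operator vanishes wherever \<open>f\<close> does not, so \<open>f = 0\<close> by positive
    definiteness, which contradicts the independence of the \<open>w x\<close> modulo 2.\<close>
  define Z where "Z = {y \<in> A. (\<lambda>i. \<not> y i) \<in> B}"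
  define w where "w = (\<lambda>x y. \<Prod>i\<in>UNIV. wing_factor (i \<in> J x) (x i) (y i))"
  assume "\<not> ?thesis"
  then have "card Z < card C" by (simp add: Z_def)
  then obtain c where c: "\<exists>x\<in>C. c x \<noteq> 0"
    and cZ: "\<And>z. z \<in> Z \<Longrightarrow> (\<Sum>x\<in>C. c x * w x z) = 0"
    using homogeneous_system_nontrivial[of Z C "\<lambda>z x. w x z"] by (meson finite)
  define f where "f = (\<lambda>y. \<Sum>x\<in>C. c x * w x y)"
  have w_supp: "y \<in> A" if "x \<in> C" "w x y \<noteq> 0" for x y
  proof (rule A[OF that(1)])
    show "y i = x i" if "i \<in> J x" for i
      using \<open>w x y \<noteq> 0\<close> that by (auto simp: w_def wing_factor_def split: if_splits)
  qed
  have gw_supp: "(\<lambda>i. \<not> z i) \<in> B"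
    if x: "x \<in> C" and nz: "(\<Sum>y\<in>UNIV. w x y * (\<Prod>i\<in>UNIV. gram (y i) (z i))) \<noteq> 0" for x z
  proof (rule B[OF x])
    fix i assume i: "i \<notin> J x"
    \<comment> \<open>The tensor and the Gram kernel are both products over coordinates, so the sum
      over \<open>y\<close> factors and no factor may vanish.\<close>
    have "(\<Prod>i\<in>UNIV. \<Sum>t\<in>UNIV. wing_factor (i \<in> J x) (x i) t * gram t (z i)) \<noteq> 0"
      using nz by (simp add: w_def prod_sum_UNIV prod.distrib)
    then have "(\<Sum>t\<in>UNIV. wing_factor (i \<in> J x) (x i) t * gram t (z i)) \<noteq> 0"
      by (simp add: prod_zero_iff)
    with i have "(\<Sum>t\<in>UNIV. wing_factor False (x i) t * gram t (z i)) \<noteq> 0" by simp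
    then show "(\<not> z i) = x i"
      using gram_wing_factor[of "x i"] by (cases "z i = x i") auto
  qed
  have "(\<Sum>y\<in>UNIV. \<Sum>z\<in>UNIV. f y * f z * (\<Prod>i\<in>UNIV. gram (y i) (z i))) =
      (\<Sum>z\<in>UNIV. f z * (\<Sum>y\<in>UNIV. f y * (\<Prod>i\<in>UNIV. gram (y i) (z i))))"
    by (subst sum.swap) (simp add: sum_distrib_left algebra_simps)
  also have "\<dots> = (\<Sum>z\<in>UNIV. f z *
      (\<Sum>x\<in>C. c x * (\<Sum>y\<in>UNIV. w x y * (\<Prod>i\<in>UNIV. gram (y i) (z i)))))"
    unfolding f_def
    by (simp only: sum_distrib_right sum_distrib_left mult.assoc)
      (intro sum.cong refl sum.swap)
  also have "\<dots> = 0"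
  proof (intro sum.neutral ballI)
    fix z :: "'n \<Rightarrow> bool"
    show "f z * (\<Sum>x\<in>C. c x * (\<Sum>y\<in>UNIV. w x y * (\<Prod>i\<in>UNIV. gram (y i) (z i)))) = 0"
    \<comment> \<open>If the antipode of \<open>z\<close> is outside \<open>B\<close>, the Gram
      image vanishes at \<open>z\<close>. Otherwise \<open>f z = 0\<close>: either \<open>z\<close>
      is outside \<open>A\<close>, off every support, or it lies in \<open>Z\<close>.\<close>
    proof (cases "(\<lambda>i. \<not> z i) \<in> B")
      case False
      then have "(\<Sum>x\<in>C. c x * (\<Sum>y\<in>UNIV. w x y * (\<Prod>i\<in>UNIV. gram (y i) (z i)))) = 0"
        using gw_supp by (intro sum.neutral) auto
      then show ?thesis by simp
    next
      case True
      have "f z = 0"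
      proof (cases "z \<in> A")
        case False
        then show ?thesis using w_supp by (auto simp: f_def intro!: sum.neutral)
      qed (use True cZ in \<open>auto simp: f_def Z_def\<close>)
      then show ?thesis by simp
    qed
  qed
  finally have f0: "f y = 0" for y by (rule tensor_gram_positive_definite)
  have "c x = 0" if "x \<in> C" for x
  proof (rule independent_if_identity_mod_2[where w = w and C = C])
    show "odd (w x x)" if "x \<in> C" for x by (simp add: w_def wing_factor_def)
    show "even (w x y)" if "x \<noteq> y" for x y
    proof -
      from that obtain i where "x i \<noteq> y i" by auto
      then have "even (wing_factor (i \<in> J x) (x i) (y i))" by (simp add: wing_factor_def)
      then show ?thesis
        unfolding w_def by (meson UNIV_I dvd_prodI dvd_trans finite)
    qed
    show "(\<Sum>x\<in>C. c x * w x y) = 0" for y using f0[of y] by (simp add: f_def)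
  qed (use that in auto)
  with c show False by blast
qed

section \<open>Analytic sets are Lebesgue measurable\<close>

text \<open>Here \<open>nat \<Rightarrow> nat\<close> carries the product topology and is Baire
  space; in a Polish space these projections are the classical Suslin sets.\<close>

definition analytic :: "'a::topological_space set \<Rightarrow> bool" where
  "analytic E \<longleftrightarrow> (\<exists>C :: ('a \<times> (nat \<Rightarrow> nat)) set. closed C \<and> E = fst ` C)"

lemma analyticI: "closed C \<Longrightarrow> E = fst ` C \<Longrightarrow> analytic E"
  for C :: "('a::topological_space \<times> (nat \<Rightarrow> nat)) set"
  unfolding analytic_def by blast

section \<open>Closure properties of analytic sets\<close>

lemma analytic_closed:
  assumes "closed E"
  shows "analytic E"
  by (rule analyticI[of "E \<times> UNIV"]) (use assms in \<open>auto intro: closed_Times\<close>)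

lemma continuous_on_reindex_sequences:
  "continuous_on UNIV (\<lambda>\<sigma> :: nat \<Rightarrow> 'b::topological_space. \<lambda>i. \<sigma> (h i))"
  by (rule continuous_on_coordinatewise_then_product) (rule continuous_on_product_coordinates)

lemma closed_reindex_sequences:
  fixes C :: "('a::topological_space \<times> (nat \<Rightarrow> nat)) set" and h :: "nat \<Rightarrow> nat"
  assumes "closed C"
  shows "closed {p. (fst p, \<lambda>i. snd p (h i)) \<in> C}"
proof -
  have "continuous_on UNIV (\<lambda>p :: 'a \<times> (nat \<Rightarrow> nat). (fst p, \<lambda>i. snd p (h i)))"
    by (rule continuous_on_Pair[OF continuous_on_fst[OF continuous_on_id]
          continuous_on_compose2[OF continuous_on_reindex_sequences continuous_on_snd[OF continuous_on_id]]])
      simp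
  from closed_vimage[OF assms this] show ?thesis by (simp add: vimage_def)
qed

text \<open>Entry 0 of the sequence names the set, and the remaining entries witness membership in
  it.\<close>

lemma analytic_UN:
  fixes E :: "nat \<Rightarrow> 'a::topological_space set"
  assumes "\<And>n. analytic (E n)"
  shows "analytic (\<Union>n. E n)"
proof -
  from assms obtain C :: "nat \<Rightarrow> ('a \<times> (nat \<Rightarrow> nat)) set"
    where C: "\<And>n. closed (C n)" "\<And>n. E n = fst ` C n"
    unfolding analytic_def by metis
  define D where "D = {p. (fst p, \<lambda>i. snd p (Suc i)) \<in> C (snd p 0)}"
  \<comment> \<open>Entry 0 lives in a discrete space, so the complement of \<open>D\<close> splits
    into open pieces, one for each value.\<close>
  have "open {p :: 'a \<times> (nat \<Rightarrow> nat). snd p 0 = n}" for n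
  proof -
    have "continuous_on UNIV (\<lambda>p :: 'a \<times> (nat \<Rightarrow> nat). snd p 0)"
      using continuous_on_product_then_coordinatewise[OF continuous_on_snd[OF continuous_on_id]] .
    from open_vimage[OF open_discrete[of "{n}"] this] show ?thesis
      by (simp add: vimage_def)
  qed
  then have "open (\<Union>n. {p. snd p 0 = n} \<inter> - {p. (fst p, \<lambda>i. snd p (Suc i)) \<in> C n})"
    by (intro open_UN ballI open_Int open_Compl closed_reindex_sequences[OF C(1)])
  moreover have "(\<Union>n. {p. snd p 0 = n} \<inter> - {p. (fst p, \<lambda>i. snd p (Suc i)) \<in> C n}) = - D"
    by (intro set_eqI) (simp add: D_def)
  ultimately have "closed D" by (simp add: closed_def)
  moreover have "(\<Union>n. E n) = fst ` D"
  proof (intro equalityI subsetI)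
    fix x assume "x \<in> (\<Union>n. E n)"
    then obtain n \<sigma> where "(x, \<sigma>) \<in> C n" by (auto simp: C)
    then have "(x, case_nat n \<sigma>) \<in> D" by (simp add: D_def)
    then show "x \<in> fst ` D" by force
  next
    fix x assume "x \<in> fst ` D"
    then show "x \<in> (\<Union>n. E n)" by (force simp: D_def C)
  qed
  ultimately show ?thesis by (rule analyticI)
qed

text \<open>One sequence carries the witnesses for all the sets, the one for \<open>E n\<close>
  being stored at the positions \<open>prod_encode (n, i)\<close>.\<close>

lemma analytic_INT:
  fixes E :: "nat \<Rightarrow> 'a::topological_space set"
  assumes "\<And>n. analytic (E n)"
  shows "analytic (\<Inter>n. E n)"
proof -
  from assms obtain C :: "nat \<Rightarrow> ('a \<times> (nat \<Rightarrow> nat)) set"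
    where C: "\<And>n. closed (C n)" "\<And>n. E n = fst ` C n"
    unfolding analytic_def by metis
  define D where "D = (\<Inter>n. {p. (fst p, \<lambda>i. snd p (prod_encode (n, i))) \<in> C n})"
  have "closed D"
    unfolding D_def by (intro closed_INT ballI closed_reindex_sequences C)
  moreover have "(\<Inter>n. E n) = fst ` D"
  proof (intro equalityI subsetI)
    fix x assume "x \<in> (\<Inter>n. E n)"
    then have "\<forall>n. \<exists>\<sigma>. (x, \<sigma>) \<in> C n" by (force simp: C)
    then obtain \<sigma> where \<sigma>: "\<And>n. (x, \<sigma> n) \<in> C n" by metis
    have "(x, \<lambda>j. case prod_decode j of (n, i) \<Rightarrow> \<sigma> n i) \<in> D"
      by (simp add: D_def \<sigma>)
    then show "x \<in> fst ` D" by force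
  qed (force simp: D_def C)
  ultimately show ?thesis by (rule analyticI)
qed

lemma analytic_open:
  fixes U :: "'a::metric_space set"
  assumes "open U"
  shows "analytic U"
proof -
  have "fsigma_in euclidean U"
    by (rule open_imp_fsigma_in[OF metrizable_space_euclidean])
      (subst open_openin[symmetric], rule assms)
  then have "\<exists>C :: nat \<Rightarrow> 'a set. (\<forall>n. closedin euclidean (C n)) \<and> \<Union> (range C) = U"
    unfolding fsigma_in_ascending by (elim exE conjE) (intro exI conjI)
  then obtain C :: "nat \<Rightarrow> 'a set" where "\<And>n. closedin euclidean (C n)" and U: "\<Union> (range C) = U"
    by blast
  then have C: "closed (C n)" for n by simp
  have "analytic (\<Union>n. C n)" by (intro analytic_UN analytic_closed C)
  with U show ?thesis by simp
qed

lemma analytic_borel: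
  fixes B :: "'a::metric_space set"
  assumes "B \<in> sets borel"
  shows "analytic B"
proof -
  have "B \<in> sigma_sets UNIV (Collect closed)"
    using assms by (simp add: borel_eq_closed)
  \<comment> \<open>Complements of analytic sets need not be analytic, so the induction carries
    both.\<close>
  then have "analytic B \<and> analytic (- B)"
  proof (induction rule: sigma_sets.induct)
    case (Basic a)
    then show ?case by (simp add: analytic_closed analytic_open open_Compl)
  next
    case Empty
    then show ?case by (simp add: analytic_closed)
  next
    case (Compl a)
    then show ?case by (simp flip: Compl_eq_Diff_UNIV)
  next
    case (Union a)
    then show ?case by (simp add: analytic_UN analytic_INT)
  qed
  then show ?thesis ..
qed

text \<open>Projecting a closed set along a compact factor leaves it closed, since the points
  \<open>y n\<close> have a convergent subsequence. So \<open>y\<close> can be removed while the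
  Baire coordinate stays.\<close>

lemma analytic_compact_projection:
  fixes E :: "('a::metric_space \<times> 'b::metric_space) set"
  assumes "analytic E" "compact K"
  shows "analytic {x. \<exists>y\<in>K. (x, y) \<in> E}"
proof -
  obtain C :: "(('a \<times> 'b) \<times> (nat \<Rightarrow> nat)) set" where C: "closed C" "E = fst ` C"
    using assms(1) unfolding analytic_def by blast
  define D where "D = {p. \<exists>y\<in>K. ((fst p, y), snd p) \<in> C}"
  have "closed D"
    unfolding closed_sequential_limits
  proof (intro allI impI, elim conjE)
    fix p l assume p: "\<forall>n. p n \<in> D" and l: "p \<longlonglongrightarrow> l"
    then have "\<forall>n. \<exists>y\<in>K. ((fst (p n), y), snd (p n)) \<in> C" by (simp add: D_def)
    then obtain y where y: "\<And>n. y n \<in> K" "\<And>n. ((fst (p n), y n), snd (p n)) \<in> C" by metis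
    from compact_imp_seq_compact[OF assms(2)] allI[OF y(1)]
    obtain z s where z: "z \<in> K" "strict_mono s" "(y \<circ> s) \<longlonglongrightarrow> z"
      by (rule seq_compactE)
    have ps: "(\<lambda>n. p (s n)) \<longlonglongrightarrow> l"
      using LIMSEQ_subseq_LIMSEQ[OF l z(2)] by (simp add: o_def)
    have "(\<lambda>n. ((fst (p (s n)), y (s n)), snd (p (s n)))) \<longlonglongrightarrow> ((fst l, z), snd l)"
      using z(3) by (intro tendsto_Pair tendsto_fst tendsto_snd ps) (simp add: o_def)
    then have "((fst l, z), snd l) \<in> C"
      by (rule closed_sequentially[OF C(1), rotated]) (simp add: y(2))
    with z(1) show "l \<in> D" by (auto simp: D_def)
  qed
  moreover have "{x. \<exists>y\<in>K. (x, y) \<in> E} = fst ` D"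
    by (intro set_eqI) (simp add: C(2) D_def image_iff Bex_def, blast)
  ultimately show ?thesis by (rule analyticI)
qed

section \<open>Capacitability of analytic sets\<close>

lemma compact_bounded_sequences: "compact {\<sigma> :: nat \<Rightarrow> nat. \<forall>i. \<sigma> i \<le> k i}"
proof -
  have "compactin (product_topology (\<lambda>_. euclidean) UNIV) (PiE UNIV (\<lambda>i. {..k i}))"
    unfolding compactin_PiE by (auto intro: finite_imp_compact)
  then show ?thesis
    by (simp add: euclidean_product_topology PiE_UNIV_domain Pi_def)
qed

text \<open>Convergence in a product is coordinatewise, and coordinate \<open>i\<close> can differ
  only for \<open>n \<le> i\<close>. This carries limits of truncated sequences back to the original
  ones.\<close>

lemma tendsto_if_agrees_initially:
  fixes \<sigma> \<tau> :: "nat \<Rightarrow> nat \<Rightarrow> 'b::topological_space"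
  assumes "\<tau> \<longlonglongrightarrow> l" and "\<And>n i. i < n \<Longrightarrow> \<sigma> n i = \<tau> n i"
  shows "\<sigma> \<longlonglongrightarrow> l"
proof -
  have tendsto_iff: "f \<longlonglongrightarrow> l \<longleftrightarrow> (\<forall>i. (\<lambda>n. f n i) \<longlonglongrightarrow> l i)"
    for f :: "nat \<Rightarrow> nat \<Rightarrow> 'b"
    using limitin_componentwise[of "\<lambda>_. euclidean" UNIV f l sequentially]
    by (simp add: euclidean_product_topology)
  have "(\<lambda>n. \<sigma> n i) \<longlonglongrightarrow> l i" for i
  proof (rule Lim_transform_eventually)
    show "(\<lambda>n. \<tau> n i) \<longlonglongrightarrow> l i" using assms(1) tendsto_iff by blast
    show "\<forall>\<^sub>F n in sequentially. \<tau> n i = \<sigma> n i"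
      using eventually_gt_at_top[of i] by eventually_elim (simp add: assms(2))
  qed
  then show ?thesis using tendsto_iff by blast
qed

theorem analytic_lebesgue_measurable:
  fixes E :: "'a::euclidean_space set"
  assumes "analytic E" and "bounded E"
  shows "E \<in> sets lebesgue"
proof -
  obtain Q :: "'a set" where Q: "compact Q" "E \<subseteq> Q"
    using assms(2) by (metis bounded_subset_cbox_symmetric compact_cbox)
  obtain C :: "('a \<times> (nat \<Rightarrow> nat)) set" where C: "closed C" "E = fst ` C"
    using assms(1) unfolding analytic_def by blast
  let ?\<mu> = "outer_measure_of lborel :: 'a set \<Rightarrow> ennreal"
  \<comment> \<open>Capacitability: bounding the coordinates of \<open>\<sigma>\<close> one after the other by suitable \<open>k n\<close> keeps the outer
    measure above \<open>a\<close>, and the projections of these sets shrink into every neighbourhood of the compact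
    set obtained in the limit.\<close>
  have inner: "\<exists>K. compact K \<and> K \<subseteq> E \<and> a \<le> emeasure lborel K" if a: "a < ?\<mu> E" for a
  proof -
    have step: "\<exists>T. a < ?\<mu> (fst ` T) \<and> (\<exists>m. T = S \<inter> {p. snd p n \<le> m})"
      if "a < ?\<mu> (fst ` S)" for S :: "('a \<times> (nat \<Rightarrow> nat)) set" and n
    proof -
      \<comment> \<open>Outer measure is continuous from below on arbitrary sets, which matters
        because the measurability of these projections is still unknown.\<close>
      have "(\<Union>m. fst ` (S \<inter> {p. snd p n \<le> m})) = fst ` S" by auto
      then have "(SUP m. ?\<mu> (fst ` (S \<inter> {p. snd p n \<le> m}))) = ?\<mu> (fst ` S)"
        by (subst SUP_outer_measure_of_incseq) (auto simp: incseq_def intro!: image_mono)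
      with that have "a < (SUP m. ?\<mu> (fst ` (S \<inter> {p. snd p n \<le> m})))" by simp
      then obtain m where "a < ?\<mu> (fst ` (S \<inter> {p. snd p n \<le> m}))"
        unfolding less_SUP_iff by blast
      then show ?thesis by blast
    qed
    have "\<exists>S. \<forall>n. (a < ?\<mu> (fst ` S n) \<and> (n = 0 \<longrightarrow> S n = C)) \<and>
        (\<exists>m. S (Suc n) = S n \<inter> {p. snd p n \<le> m})"
    proof (rule dependent_nat_choice)
      show "\<exists>T. a < ?\<mu> (fst ` T) \<and> (0 = 0 \<longrightarrow> T = C)" using a C(2) by blast
      show "\<exists>T'. (a < ?\<mu> (fst ` T') \<and> (Suc n = 0 \<longrightarrow> T' = C)) \<and> (\<exists>m. T' = T \<inter> {p. snd p n \<le> m})"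
        if "a < ?\<mu> (fst ` T) \<and> (n = 0 \<longrightarrow> T = C)" for T n
        using step[of T n] that by simp
    qed
    then obtain S where S: "\<And>n. a < ?\<mu> (fst ` S n)" "S 0 = C"
      and "\<And>n. \<exists>m. S (Suc n) = S n \<inter> {p. snd p n \<le> m}" by blast
    then obtain k where k: "\<And>n. S (Suc n) = S n \<inter> {p. snd p n \<le> k n}" by metis
    have S_eq: "S n = C \<inter> {p. \<forall>i<n. snd p i \<le> k i}" for n
      by (induction n) (auto simp: S(2) k less_Suc_eq)
    \<comment> \<open>All bounds are imposed at once. Since \<open>E \<subseteq> Q\<close>,
      intersecting with \<open>Q\<close> removes no point of \<open>C\<close> but gives
      compactness.\<close>
    define P where "P = C \<inter> Q \<times> {\<sigma>. \<forall>i. \<sigma> i \<le> k i}"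
    have "compact P"
      unfolding P_def by (intro closed_Int_compact C compact_Times Q compact_bounded_sequences)
    then have K: "compact (fst ` P)" by (intro compact_continuous_image continuous_intros)
    have nbhd: "\<exists>n. fst ` S n \<subseteq> U" if U: "open U" "fst ` P \<subseteq> U" for U
    proof (rule ccontr)
      assume "\<not> ?thesis"
      then have "\<forall>n. \<exists>p. p \<in> S n \<and> fst p \<notin> U" by blast
      then obtain p where p: "\<And>n. p n \<in> S n" "\<And>n. fst (p n) \<notin> U" by metis
      \<comment> \<open>Truncating at \<open>k\<close> moves the points into a compact set. Points
        of \<open>S n\<close> keep their first \<open>n\<close> entries, so along the subsequence
        \<open>p\<close> has the same limit, which would lie in \<open>P\<close> but project outside
        \<open>U\<close>.\<close>
      define q where "q n = (fst (p n), \<lambda>i. min (snd (p n) i) (k i))" for n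
      have pC: "p n \<in> C" for n using p(1) by (simp add: S_eq)
      have qR: "\<forall>n. q n \<in> Q \<times> {\<sigma>. \<forall>i. \<sigma> i \<le> k i}"
        using pC C Q by (force simp: q_def)
      have "seq_compact (Q \<times> {\<sigma>. \<forall>i. \<sigma> i \<le> k i})"
        by (intro compact_imp_seq_compact compact_Times Q compact_bounded_sequences)
      from this qR obtain l s
        where l: "l \<in> Q \<times> {\<sigma>. \<forall>i. \<sigma> i \<le> k i}" "strict_mono s" "(q \<circ> s) \<longlonglongrightarrow> l"
        by (rule seq_compactE)
      have fst_lim: "(\<lambda>n. fst (p (s n))) \<longlonglongrightarrow> fst l"
        using tendsto_fst[OF l(3)] by (simp add: q_def o_def)
      have "(\<lambda>n. snd (q (s n))) \<longlonglongrightarrow> snd l"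
        using tendsto_snd[OF l(3)] by (simp add: o_def)
      then have "(\<lambda>n. snd (p (s n))) \<longlonglongrightarrow> snd l"
      proof (rule tendsto_if_agrees_initially)
        fix n i :: nat assume "i < n"
        then have "i < s n" using seq_suble[OF l(2), of n] by simp
        then show "snd (p (s n)) i = snd (q (s n)) i"
          using p(1)[of "s n"] by (auto simp: S_eq q_def)
      qed
      with fst_lim have "(\<lambda>n. (fst (p (s n)), snd (p (s n)))) \<longlonglongrightarrow> (fst l, snd l)"
        by (rule tendsto_Pair)
      then have "(fst l, snd l) \<in> C"
        by (rule closed_sequentially[OF C(1), rotated]) (simp add: pC)
      then have "l \<in> C" by simp
      with l(1) have "fst l \<in> U" using U(2) by (auto simp: P_def)
      moreover have "fst l \<in> - U"
        by (rule closed_sequentially[OF _ _ fst_lim]) (use U(1) p(2) in auto)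
      ultimately show False by simp
    qed
    have "a \<le> emeasure lborel (fst ` P)"
    proof (rule ennreal_le_epsilon)
      fix e :: real assume e: "0 < e"
      have KB: "fst ` P \<in> sets borel" using K by (simp add: borel_compact)
      \<comment> \<open>By outer regularity \<open>U\<close> has almost the measure of the
        projection of \<open>P\<close>, yet it contains the projection of some \<open>S n\<close>,
        of outer measure above \<open>a\<close>.\<close>
      obtain U where U: "open U" "fst ` P \<subseteq> U" "emeasure lborel (U - fst ` P) < ennreal e"
        using outer_regular_lborel[OF KB e] by metis
      obtain n where n: "fst ` S n \<subseteq> U" using nbhd U by blast
      have "a \<le> ?\<mu> (fst ` S n)" using S(1)[of n] by simp
      also have "\<dots> \<le> ?\<mu> U" using n by (rule outer_measure_of_mono)
      also have "\<dots> = emeasure lborel U" using U(1) by (simp add: borel_open)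
      also have "\<dots> = emeasure lborel (fst ` P \<union> (U - fst ` P))"
        using U(2) by (simp add: Un_absorb1)
      also have "\<dots> \<le> emeasure lborel (fst ` P) + emeasure lborel (U - fst ` P)"
        using KB U(1) by (intro emeasure_subadditive) (auto simp: borel_open)
      also have "\<dots> \<le> emeasure lborel (fst ` P) + ennreal e"
        using U(3) by (intro add_left_mono) auto
      finally show "a \<le> emeasure lborel (fst ` P) + ennreal e" .
    qed
    moreover have "fst ` P \<subseteq> E" by (auto simp: P_def C)
    ultimately show ?thesis using K by blast
  qed
  obtain H where H: "H \<in> sets borel" "E \<subseteq> H" "?\<mu> E = emeasure lborel H"
    using outer_measure_of_attain[of E lborel] by auto
  have fin: "?\<mu> E < \<infinity>"
  proof -
    have "?\<mu> E \<le> ?\<mu> Q" using Q(2) by (rule outer_measure_of_mono)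
    also have "\<dots> < \<infinity>"
      using Q(1) emeasure_compact_finite[OF Q(1)] by (simp add: borel_compact)
    finally show ?thesis .
  qed
  \<comment> \<open>\<open>L\<close> is a countable union of compact sets whose measures approach
    the outer measure. Approximation strictly from below needs a positive target, hence the case
    split.\<close>
  obtain L where L: "L \<in> sets borel" "L \<subseteq> E" "?\<mu> E \<le> emeasure lborel L"
  proof (cases "?\<mu> E = 0")
    case True
    then show ?thesis using that[of "{}"] by simp
  next
    case False
    then obtain u where u: "\<And>n::nat. u n < ?\<mu> E" "u \<longlonglongrightarrow> ?\<mu> E"
      using approx_from_below_dense_linorder[of 0 "?\<mu> E"] by (auto simp: zero_less_iff_neq_zero)
    obtain K where K: "\<And>n. compact (K n)" "\<And>n. K n \<subseteq> E" "\<And>n. u n \<le> emeasure lborel (K n)"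
      using inner[OF u(1)] by metis
    have B: "(\<Union>n. K n) \<in> sets borel" using K(1) by (auto simp: borel_compact)
    have "u n \<le> emeasure lborel (\<Union>n. K n)" for n
      using K(3)[of n] B emeasure_mono[of "K n" "\<Union>n. K n" lborel] by (auto intro: order_trans)
    then have "?\<mu> E \<le> emeasure lborel (\<Union>n. K n)"
      by (intro LIMSEQ_le_const2[OF u(2)]) auto
    with B K(2) show ?thesis by (intro that) auto
  qed
  have "emeasure lborel (H - L) = emeasure lborel H - emeasure lborel L"
    using L H fin emeasure_mono[of L H lborel] by (intro emeasure_Diff) (auto simp: top_unique)
  also have "\<dots> = 0" using L(3) H(3) fin by (simp add: diff_eq_0_iff_ennreal fin[unfolded H(3)])
  finally have "H - L \<in> null_sets lborel" using H L by (auto simp: null_sets_def)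
  then show ?thesis
    using L H by (intro sets_completionI[of _ L "E - L" "H - L"]) auto
qed

section \<open>The inequality for two sets\<close>

definition mix :: "('n::finite \<Rightarrow> bool) \<Rightarrow> real^'n \<Rightarrow> real^'n \<Rightarrow> real^'n" where
  "mix w x y = (\<chi> i. if w i then x $ i else y $ i)"

lemma mix_nth [simp]: "mix w x y $ i = (if w i then x $ i else y $ i)"
  by (simp add: mix_def)

text \<open>This exchanges the coordinates where \<open>w\<close> is false, so it is a coordinate
  permutation and an involution; the second component is the antipode of the first.\<close>

definition mix_pair :: "('n::finite \<Rightarrow> bool) \<Rightarrow> (real^'n) \<times> (real^'n) \<Rightarrow> (real^'n) \<times> (real^'n)" where
  "mix_pair w p = (mix w (fst p) (snd p), mix w (snd p) (fst p))"

lemma borel_measurable_mix_pair [measurable]: "mix_pair w \<in> borel_measurable borel"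
proof (rule borel_measurable_continuous_onI)
  have "continuous_on UNIV (\<lambda>p :: (real^'n) \<times> (real^'n). if b then fst p $ i else snd p $ i)" for b i
    by (cases b) (auto intro!: continuous_intros)
  moreover have "continuous_on UNIV (\<lambda>p :: (real^'n) \<times> (real^'n). if b then snd p $ i else fst p $ i)" for b i
    by (cases b) (auto intro!: continuous_intros)
  ultimately show "continuous_on UNIV (mix_pair w)"
    unfolding mix_pair_def mix_def
    by (intro continuous_on_Pair continuous_on_vec_lambda)
qed

text \<open>Applied to side lengths, this shows that exchanging the \<open>i\<close>-th coordinates
  of the two components preserves the volume of a box.\<close>

lemma prod_Basis_vec_pair:
  "(\<Prod>b\<in>Basis. v \<bullet> b) = (\<Prod>i\<in>UNIV. fst v $ i * snd v $ i)"
  for v :: "(real^'n) \<times> (real^'n)"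
proof -
  have vec: "(\<Prod>b\<in>Basis. v \<bullet> b) = (\<Prod>i\<in>UNIV. v $ i)" for v :: "real^'n"
  proof -
    have "Basis = range (\<lambda>i. axis i (1::real) :: real^'n)" by (auto simp: Basis_vec_def)
    then have "(\<Prod>b\<in>Basis. v \<bullet> b) = (\<Prod>b\<in>range (\<lambda>i. axis i (1::real)). v \<bullet> b)"
      by (rule arg_cong)
    also have "\<dots> = (\<Prod>i\<in>UNIV. v $ i)"
      by (subst prod.reindex) (auto simp: inj_on_def axis_eq_axis inner_axis)
    finally show ?thesis .
  qed
  have "(\<Prod>b\<in>Basis. v \<bullet> b) = (\<Prod>b\<in>Basis. fst v \<bullet> b) * (\<Prod>b\<in>Basis. snd v \<bullet> b)"
    unfolding Basis_prod_def
    by (subst prod.union_disjoint)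
      (auto simp: prod.reindex inj_on_def inner_prod_def)
  then show ?thesis by (simp add: vec prod.distrib)
qed

text \<open>An involutive coordinate permutation pulls a box back to the box with permuted corners,
  of equal volume; the values on boxes determine Lebesgue measure.\<close>

lemma distr_mix_pair:
  fixes w :: "'n::finite \<Rightarrow> bool"
  shows "distr lborel borel (mix_pair w) = (lborel :: ((real^'n) \<times> (real^'n)) measure)"
proof (rule lborel_eqI[symmetric])
  fix l u :: "(real^'n) \<times> (real^'n)"
  assume le: "\<And>b. b \<in> Basis \<Longrightarrow> l \<bullet> b \<le> u \<bullet> b"
  have mem_box: "p \<in> box a b \<longleftrightarrow>
      (\<forall>i. fst a $ i < fst p $ i \<and> fst p $ i < fst b $ i \<and> snd a $ i < snd p $ i \<and> snd p $ i < snd b $ i)"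
    for p a b :: "(real^'n) \<times> (real^'n)"
    by (cases p; cases a; cases b) (auto simp: box_prod mem_box_cart)
  have "(l \<bullet> (axis i 1, 0) \<le> u \<bullet> (axis i 1, 0)) \<and> (l \<bullet> (0, axis i 1) \<le> u \<bullet> (0, axis i 1))" for i :: 'n
    by (intro conjI le) (auto simp: Basis_prod_def Basis_vec_def)
  then have le': "fst l $ i \<le> fst u $ i" "snd l $ i \<le> snd u $ i" for i
    by (auto simp: inner_prod_def inner_axis)
  have "mix_pair w -` box l u = box (mix_pair w l) (mix_pair w u)"
    by (auto simp: mem_box mix_pair_def split: if_splits)
  then have "emeasure (distr lborel borel (mix_pair w)) (box l u) =
      emeasure lborel (box (mix_pair w l) (mix_pair w u))"
    by (subst emeasure_distr) auto
  also have "\<dots> = (\<Prod>b\<in>Basis. (mix_pair w u - mix_pair w l) \<bullet> b)"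
    by (rule emeasure_lborel_box)
      (auto simp: Basis_prod_def Basis_vec_def inner_prod_def inner_axis mix_pair_def le')
  also have "\<dots> = (\<Prod>b\<in>Basis. (u - l) \<bullet> b)"
    unfolding prod_Basis_vec_pair
    by (intro arg_cong[where f = ennreal] prod.cong) (auto simp: mix_pair_def)
  finally show "emeasure (distr lborel borel (mix_pair w)) (box l u) = (\<Prod>b\<in>Basis. (u - l) \<bullet> b)" .
qed simp

lemma emeasure_vimage_mix_pair:
  assumes "A \<in> sets borel" "B \<in> sets borel"
  shows "emeasure lborel (mix_pair w -` (A \<times> B)) = emeasure lborel A * emeasure lborel B"
proof -
  have "A \<times> B \<in> sets borel" using assms by (rule borel_Times)
  then have "emeasure lborel (mix_pair w -` (A \<times> B)) = emeasure (distr lborel borel (mix_pair w)) (A \<times> B)"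
    by (subst emeasure_distr) auto
  also have "\<dots> = emeasure (lborel \<Otimes>\<^sub>M lborel) (A \<times> B)"
    by (simp add: distr_mix_pair lborel_prod)
  also have "\<dots> = emeasure lborel A * emeasure lborel B"
    using assms by (simp add: lborel.emeasure_pair_measure_Times)
  finally show ?thesis .
qed

text \<open>Disjoint index sets may be enlarged to complementary ones, because
  \<open>cyl_interior\<close> grows with its index set; so a single \<open>K\<close>
  suffices.\<close>

definition bkr_box2 :: "(real^'n) set \<Rightarrow> (real^'n) set \<Rightarrow> (real^'n) set" where
  "bkr_box2 A B = (\<Union>K. cyl_interior K A \<inter> cyl_interior (- K) B)"

text \<open>Choices \<open>w\<close> that agree on \<open>K\<close> give mixtures that agree on
  \<open>K\<close>, so witnesses for the box pull back to the discrete cube. Negating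
  \<open>w\<close> exchanges \<open>x\<close> and \<open>y\<close>.\<close>

lemma card_mix_bkr_box2_le:
  fixes x y :: "real^'n"
  assumes "x \<in> unit_cube" "y \<in> unit_cube"
  shows "card {w. mix w x y \<in> bkr_box2 A B} \<le>
    card {w. mix w x y \<in> A \<and> mix w y x \<in> B}"
proof -
  define C where "C = {w. mix w x y \<in> bkr_box2 A B}"
  have mix_cube: "mix w x y \<in> unit_cube" for w
    using assms by (simp add: unit_cube_def)
  have "\<forall>w\<in>C. \<exists>K. mix w x y \<in> cyl_interior K A \<and> mix w x y \<in> cyl_interior (- K) B"
    by (auto simp: C_def bkr_box2_def)
  then obtain J where J: "\<And>w. w \<in> C \<Longrightarrow> mix w x y \<in> cyl_interior (J w) A"
    "\<And>w. w \<in> C \<Longrightarrow> mix w x y \<in> cyl_interior (- J w) B"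
    by metis
  have "card C \<le> card {w \<in> {w. mix w x y \<in> A}. (\<lambda>i. \<not> w i) \<in> {w. mix w x y \<in> B}}"
  proof (rule reimer_cube[where J = J])
    show "v \<in> {w. mix w x y \<in> A}" if "w \<in> C" "\<And>i. i \<in> J w \<Longrightarrow> v i = w i" for w v
      using J(1)[OF that(1)] that(2) mix_cube by (auto simp: cyl_interior_def cyl_def)
    show "v \<in> {w. mix w x y \<in> B}" if "w \<in> C" "\<And>i. i \<notin> J w \<Longrightarrow> v i = w i" for w v
      using J(2)[OF that(1)] that(2) mix_cube by (auto simp: cyl_interior_def cyl_def)
  qed
  also have "{w \<in> {w. mix w x y \<in> A}. (\<lambda>i. \<not> w i) \<in> {w. mix w x y \<in> B}} =
      {w. mix w x y \<in> A \<and> mix w y x \<in> B}"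
  proof -
    have "mix (\<lambda>i. \<not> w i) x y = mix w y x" for w by (simp add: vec_eq_iff)
    then show ?thesis by simp
  qed
  finally show ?thesis by (simp add: C_def)
qed

lemma emeasure_unit_cube: "emeasure lborel (unit_cube :: (real^'n) set) = 1"
proof -
  have "(1 :: real^'n) \<bullet> b = 1" if "b \<in> Basis" for b
    using that unfolding Basis_vec_def by (auto simp: inner_axis)
  then show ?thesis
    unfolding unit_cube_eq_cbox by (subst emeasure_lborel_cbox) auto
qed

lemma sets_borel_unit_cube [simp, measurable]: "unit_cube \<in> sets borel"
  by (simp add: unit_cube_eq_cbox)

text \<open>The counting inequality is integrated over all pairs of points. The Borel set
  \<open>C\<close> stands in for the box, so that the integrands are Borel measurable.\<close>

lemma emeasure_le_if_subset_bkr_box2: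
  fixes A B C :: "(real^'n) set"
  assumes A: "A \<in> sets borel" and B: "B \<in> sets borel" and C: "C \<in> sets borel"
    and sub: "C \<subseteq> unit_cube" "C \<subseteq> bkr_box2 A B"
  shows "emeasure lborel C \<le> emeasure lborel A * emeasure lborel B"
proof -
  have meas: "mix_pair w -` (X \<times> Y) \<in> sets borel"
    if "X \<in> sets borel" "Y \<in> sets borel" for X Y :: "(real^'n) set" and w
    using measurable_sets[OF borel_measurable_mix_pair borel_Times[OF that], of w] by simp
  have sum_ind: "(\<Sum>w\<in>UNIV. indicator (mix_pair w -` (X \<times> Y)) p) =
      (of_nat (card {w. mix w (fst p) (snd p) \<in> X \<and> mix w (snd p) (fst p) \<in> Y}) :: ennreal)"
    for X Y :: "(real^'n) set" and p
    by (simp add: indicator_def mix_pair_def flip: sum.inter_filter of_nat_sum card_eq_sum)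
  have integral: "(\<integral>\<^sup>+p. (\<Sum>w\<in>UNIV. indicator (mix_pair w -` (X \<times> Y)) p) \<partial>lborel) =
      of_nat CARD('n \<Rightarrow> bool) * (emeasure lborel X * emeasure lborel Y)"
    if "X \<in> sets borel" "Y \<in> sets borel" for X Y :: "(real^'n) set"
    using meas[OF that] by (subst nn_integral_sum) (auto simp: emeasure_vimage_mix_pair that)
  \<comment> \<open>The factor \<open>unit_cube\<close> has measure 1 and puts the antipode into the
    cube; pairs with a point outside the cube then contribute 0.\<close>
  have "of_nat CARD('n \<Rightarrow> bool) * emeasure lborel C =
      (\<integral>\<^sup>+p. (\<Sum>w\<in>UNIV. indicator (mix_pair w -` (C \<times> unit_cube)) p) \<partial>lborel)"
    by (simp add: integral C emeasure_unit_cube)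
  also have "\<dots> \<le> (\<integral>\<^sup>+p. (\<Sum>w\<in>UNIV. indicator (mix_pair w -` (A \<times> B)) p) \<partial>lborel)"
  proof (rule nn_integral_mono)
    fix p :: "(real^'n) \<times> (real^'n)"
    let ?L = "{w. mix w (fst p) (snd p) \<in> C \<and> mix w (snd p) (fst p) \<in> unit_cube}"
    let ?R = "{w. mix w (fst p) (snd p) \<in> A \<and> mix w (snd p) (fst p) \<in> B}"
    have "card ?L \<le> card ?R"
    proof (cases "?L = {}")
      case True
      then show ?thesis by (metis card.empty le0)
    next
      case False
      then obtain w where "mix w (fst p) (snd p) \<in> unit_cube" "mix w (snd p) (fst p) \<in> unit_cube"
        using sub(1) by auto
      then have "fst p $ i \<in> {0..1} \<and> snd p $ i \<in> {0..1}" for i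
        unfolding unit_cube_def by (cases "w i") (auto dest!: spec[of _ i])
      then have "fst p \<in> unit_cube" "snd p \<in> unit_cube" by (auto simp: unit_cube_def)
      then have "card {w. mix w (fst p) (snd p) \<in> bkr_box2 A B} \<le> card ?R"
        by (rule card_mix_bkr_box2_le)
      moreover have "card ?L \<le> card {w. mix w (fst p) (snd p) \<in> bkr_box2 A B}"
        using sub(2) by (intro card_mono) auto
      ultimately show ?thesis by simp
    qed
    then show "(\<Sum>w\<in>UNIV. indicator (mix_pair w -` (C \<times> unit_cube)) p)
        \<le> (\<Sum>w\<in>UNIV. indicator (mix_pair w -` (A \<times> B)) p :: ennreal)"
      unfolding sum_ind by simp
  qed
  also have "\<dots> = of_nat CARD('n \<Rightarrow> bool) * (emeasure lborel A * emeasure lborel B)"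
    by (rule integral[OF A B])
  finally show ?thesis
    by (subst (asm) ennreal_mult_le_mult_iff) auto
qed

lemma lebesgue_measurable_cyl_interior:
  fixes A :: "(real^'n) set"
  assumes A: "A \<in> sets borel"
  shows "cyl_interior K A \<in> sets lebesgue"
proof -
  \<comment> \<open>\<open>E\<close> consists of pairs \<open>(x, y)\<close> agreeing on
    \<open>K\<close> with \<open>y\<close> outside \<open>A\<close>, so \<open>D\<close> collects
    the points of the cube whose cylinder leaves \<open>A\<close>.\<close>
  define G where "G = {p :: (real^'n) \<times> (real^'n). \<forall>i\<in>K. snd p $ i = fst p $ i}"
  define E where "E = unit_cube \<times> (- A) \<inter> G"
  define D where "D = {x. \<exists>y\<in>unit_cube. (x, y) \<in> E}"
  have "closed G"
  proof -
    have "G = (\<Inter>i\<in>K. {p. snd p $ i = fst p $ i})" by (auto simp: G_def)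
    moreover have "closed {p :: (real^'n) \<times> (real^'n). snd p $ i = fst p $ i}" for i
      by (intro closed_Collect_eq continuous_intros)
    ultimately show ?thesis by (simp add: closed_INT)
  qed
  then have "G \<in> sets borel" by (rule borel_closed)
  moreover have "unit_cube \<times> (- A) \<in> sets borel"
    by (intro borel_Times sets_borel_unit_cube borel_comp A)
  ultimately have "E \<in> sets borel" unfolding E_def by (rule sets.Int[rotated])
  then have "analytic E" by (rule analytic_borel)
  then have "analytic D"
    unfolding D_def by (intro analytic_compact_projection) (simp_all add: unit_cube_eq_cbox)
  moreover have "bounded D"
    by (rule bounded_subset[of unit_cube]) (auto simp: D_def E_def unit_cube_eq_cbox)
  ultimately have D: "D \<in> sets lebesgue" by (rule analytic_lebesgue_measurable)
  have cube: "(unit_cube :: (real^'n) set) \<in> sets lebesgue" by (simp add: unit_cube_eq_cbox)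
  have "cyl_interior K A = unit_cube - D"
    by (auto simp: cyl_interior_def cyl_def D_def E_def G_def)
  with sets.Diff[OF cube D] show ?thesis by (rule ssubst[rotated])
qed

section \<open>More than two sets\<close>

lemma mem_bkr_box:
  "x \<in> bkr_box r A \<longleftrightarrow>
    (\<exists>J. disjoint_family_on J {1..r} \<and> (\<forall>i\<in>{1..r}. x \<in> cyl_interior (J i) (A i)))"
  unfolding bkr_box_def by simp

text \<open>Normalising \<open>J\<close> outside \<open>{1..r}\<close> leaves finitely many tuples,
  so the box becomes a finite union of measurable sets.\<close>

lemma bkr_box_restrict:
  "bkr_box r A = (\<Union>J\<in>{J \<in> {1..r} \<rightarrow>\<^sub>E UNIV. disjoint_family_on J {1..r}}.
    \<Inter>i\<in>{1..r}. cyl_interior (J i) (A i))" (is "_ = (\<Union>J\<in>?F. ?I J)")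
proof (rule equalityI)
  show "bkr_box r A \<subseteq> (\<Union>J\<in>?F. ?I J)"
  proof
    fix x assume "x \<in> bkr_box r A"
    then obtain J where J: "disjoint_family_on J {1..r}" "\<forall>i\<in>{1..r}. x \<in> cyl_interior (J i) (A i)"
      unfolding mem_bkr_box by blast
    have "restrict J {1..r} \<in> ?F" using J(1) by (simp add: disjoint_family_on_def)
    moreover have "x \<in> ?I (restrict J {1..r})" using J(2) by simp
    ultimately show "x \<in> (\<Union>J\<in>?F. ?I J)" by (rule UN_I[where B = ?I])
  qed
  show "(\<Union>J\<in>?F. ?I J) \<subseteq> bkr_box r A"
    unfolding bkr_box_def by (rule UN_mono) auto
qed

lemma cyl_interior_subset: "cyl_interior K A \<subseteq> A \<inter> unit_cube"
  by (auto simp: cyl_interior_def cyl_def)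

text \<open>For \<open>r = 0\<close> the empty intersection would make the box the whole
  space.\<close>

lemma bkr_box_subset:
  assumes "r \<ge> 1"
  shows "bkr_box r A \<subseteq> A 1 \<inter> unit_cube"
proof
  fix x assume "x \<in> bkr_box r A"
  then obtain J where "\<forall>i\<in>{1..r}. x \<in> cyl_interior (J i) (A i)"
    unfolding mem_bkr_box by blast
  then have "x \<in> cyl_interior (J 1) (A 1)" using assms by simp
  then show "x \<in> A 1 \<inter> unit_cube" using cyl_interior_subset by blast
qed

lemma cyl_interior_mono:
  fixes A B :: "(real^'n) set"
  assumes "K \<subseteq> L" "A \<subseteq> B"
  shows "cyl_interior K A \<subseteq> cyl_interior L B"
proof
  fix x assume x: "x \<in> cyl_interior K A"
  have "cyl L x \<subseteq> cyl K x" using assms(1) by (auto simp: cyl_def)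
  with x assms(2) show "x \<in> cyl_interior L B" by (auto simp: cyl_interior_def)
qed

lemma bkr_box_mono: "(\<And>i. i \<in> {1..r} \<Longrightarrow> A i \<subseteq> B i) \<Longrightarrow> bkr_box r A \<subseteq> bkr_box r B"
  unfolding bkr_box_def by (intro UN_mono INT_anti_mono cyl_interior_mono) auto

lemma bkr_box_measurable:
  fixes A :: "nat \<Rightarrow> (real^'n) set"
  assumes "r \<ge> 1" "\<And>i. i \<in> {1..r} \<Longrightarrow> A i \<in> sets borel"
  shows "bkr_box r A \<in> sets cube_lebesgue_measure"
proof -
  have "finite {J :: nat \<Rightarrow> 'n set. J \<in> {1..r} \<rightarrow>\<^sub>E UNIV \<and> disjoint_family_on J {1..r}}"
    by (rule finite_subset[of _ "{1..r} \<rightarrow>\<^sub>E UNIV"]) (auto intro!: finite_PiE)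
  then have "bkr_box r A \<in> sets lebesgue"
    unfolding bkr_box_restrict using assms
    by (intro sets.finite_UN sets.finite_INT lebesgue_measurable_cyl_interior) auto
  then show ?thesis
    using bkr_box_subset[OF assms(1), of A] by (simp add: sets_cube_lebesgue_measure)
qed

lemma completion_inner_outer:
  assumes "S \<in> sets (completion M)"
  shows "\<exists>L\<in>sets M. \<exists>U\<in>sets M. L \<subseteq> S \<and> S \<subseteq> U \<and>
    emeasure M L = emeasure (completion M) S \<and> emeasure M U = emeasure (completion M) S"
proof -
  obtain L N N' where *: "S = L \<union> N" "N \<subseteq> N'" "N' \<in> null_sets M" "L \<in> sets M"
    using assms by (rule sets_completionE)
  have U: "L \<union> N' \<in> sets M" using * by auto
  have eq: "emeasure M (L \<union> N') = emeasure M L"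
    using * by (simp add: emeasure_Un_null_set)
  have sub: "L \<subseteq> S" "S \<subseteq> L \<union> N'" using * by auto
  have ext: "emeasure (completion M) X = emeasure M X" if "X \<in> sets M" for X
    using that by simp
  have "emeasure M L \<le> emeasure (completion M) S"
    unfolding ext[OF *(4), symmetric] using sub(1) assms by (rule emeasure_mono)
  moreover have "emeasure (completion M) S \<le> emeasure M (L \<union> N')"
    unfolding ext[OF U, symmetric] using sub(2) U by (intro emeasure_mono) auto
  ultimately have "emeasure M L = emeasure (completion M) S"
    unfolding eq by (rule antisym)
  with eq have "emeasure M (L \<union> N') = emeasure (completion M) S" by (rule trans)
  with \<open>emeasure M L = _\<close> show ?thesis using *(4) U sub by blast
qed

text \<open>Let \<open>K\<close> be the union of the first \<open>r\<close> index sets. Every point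
  of the cylinder of \<open>x\<close> over \<open>K\<close> lies in the box of the first
  \<open>r\<close> sets with the same witnesses, hence in \<open>D\<close>; the last index set
  avoids \<open>K\<close>.\<close>

lemma bkr_box_Suc_subset:
  fixes A :: "nat \<Rightarrow> (real^'n) set"
  assumes D: "bkr_box r A \<subseteq> D"
  shows "bkr_box (Suc r) A \<subseteq> bkr_box2 D (A (Suc r))"
proof
  fix x assume "x \<in> bkr_box (Suc r) A"
  then obtain J where J: "disjoint_family_on J {1..Suc r}"
    and x: "\<And>i. i \<in> {1..Suc r} \<Longrightarrow> x \<in> cyl_interior (J i) (A i)"
    unfolding mem_bkr_box by blast
  define K where "K = (\<Union>i\<in>{1..r}. J i)"
  have "x \<in> cyl_interior K D"
    unfolding cyl_interior_def
  proof (intro CollectI conjI subsetI)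
    show "x \<in> unit_cube" using x[of "Suc r"] by (simp add: cyl_interior_def)
    fix y assume y: "y \<in> cyl K x"
    have "y \<in> cyl_interior (J i) (A i)" if "i \<in> {1..r}" for i
    proof -
      have "y $ j = x $ j" if "j \<in> J i" for j
        using y \<open>i \<in> {1..r}\<close> that by (auto simp: cyl_def K_def)
      then show ?thesis
        using x[of i] y that by (auto simp: cyl_interior_def cyl_def)
    qed
    moreover have "disjoint_family_on J {1..r}"
      using J by (auto simp: disjoint_family_on_def)
    ultimately have "y \<in> bkr_box r A" unfolding mem_bkr_box by blast
    with D show "y \<in> D" by blast
  qed
  moreover have "J (Suc r) \<subseteq> - K"
  proof -
    have "J (Suc r) \<inter> J i = {}" if "i \<in> {1..r}" for i
      using J that by (intro disjoint_family_onD[where I = "{1..Suc r}"]) auto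
    then show ?thesis unfolding K_def by blast
  qed
  then have "x \<in> cyl_interior (- K) (A (Suc r))"
    using x[of "Suc r"] cyl_interior_mono[of "J (Suc r)" "- K" "A (Suc r)" "A (Suc r)"] by auto
  ultimately show "x \<in> bkr_box2 D (A (Suc r))" by (auto simp: bkr_box2_def)
qed

theorem bkr_box_borel:
  fixes A :: "nat \<Rightarrow> (real^'n) set"
  assumes "r \<ge> 1" "\<And>i. i \<in> {1..r} \<Longrightarrow> A i \<in> sets cube_borel_measure"
  shows "emeasure cube_lebesgue_measure (bkr_box r A) \<le> (\<Prod>i\<in>{1..r}. emeasure cube_borel_measure (A i))"
  using assms
proof (induction r rule: dec_induct)
  case base
  have A: "A 1 \<in> sets cube_borel_measure" using base by simp
  have "bkr_box 1 A \<subseteq> A 1" using bkr_box_subset[of 1 A] by simp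
  then have "emeasure cube_lebesgue_measure (bkr_box 1 A) \<le> emeasure cube_lebesgue_measure (A 1)"
    using A by (intro emeasure_mono) (auto simp: cube_lebesgue_measure_def)
  also have "\<dots> = emeasure cube_borel_measure (A 1)"
    using A by (simp add: cube_lebesgue_measure_def)
  finally show ?case by simp
next
  case (step r)
  have borel: "A i \<in> sets borel" if "i \<in> {1..Suc r}" for i
    using step.prems that by (auto simp: sets_cube_borel_measure)
  have "bkr_box r A \<in> sets (completion cube_borel_measure)"
    "bkr_box (Suc r) A \<in> sets (completion cube_borel_measure)"
    using bkr_box_measurable[of r A] bkr_box_measurable[of "Suc r" A] borel step.hyps
    by (auto simp: cube_lebesgue_measure_def)
  \<comment> \<open>The two-set inequality takes Borel sets: \<open>D\<close> is a hull of the old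
    box and \<open>C\<close> an inner set of the new one, both without change of measure.\<close>
  from this[THEN completion_inner_outer]
  obtain D C where D: "D \<in> sets cube_borel_measure" "bkr_box r A \<subseteq> D"
      "emeasure cube_borel_measure D = emeasure cube_lebesgue_measure (bkr_box r A)"
    and C: "C \<in> sets cube_borel_measure" "C \<subseteq> bkr_box (Suc r) A"
      "emeasure cube_borel_measure C = emeasure cube_lebesgue_measure (bkr_box (Suc r) A)"
    unfolding cube_lebesgue_measure_def by metis
  have A: "A (Suc r) \<in> sets cube_borel_measure" using step.prems by simp
  have "emeasure cube_borel_measure C \<le> emeasure cube_borel_measure D * emeasure cube_borel_measure (A (Suc r))"
    using A C D bkr_box_Suc_subset[OF D(2)] emeasure_le_if_subset_bkr_box2[of D "A (Suc r)" C]
    by (auto simp: sets_cube_borel_measure emeasure_cube_borel_measure)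
  also have "\<dots> \<le> (\<Prod>i\<in>{1..r}. emeasure cube_borel_measure (A i)) * emeasure cube_borel_measure (A (Suc r))"
    unfolding D(3) using step by (intro mult_right_mono) auto
  also have "\<dots> = (\<Prod>i\<in>{1..Suc r}. emeasure cube_borel_measure (A i))" by simp
  finally show ?case by (simp only: C(3))
qed

theorem theorem5:
  fixes r :: nat
  assumes "r \<ge> 2"
  shows "(\<forall>A :: nat \<Rightarrow> (real^'n) set.
            (\<forall>i\<in>{1..r}. A i \<in> sets cube_borel_measure) \<longrightarrow>
              bkr_box r A \<in> sets cube_lebesgue_measure \<and>
              emeasure cube_lebesgue_measure (bkr_box r A)
                \<le> (\<Prod>i\<in>{1..r}. emeasure cube_borel_measure (A i)))
       \<and> (\<forall>A :: nat \<Rightarrow> (real^'n) set.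
            (\<forall>i\<in>{1..r}. A i \<in> sets cube_lebesgue_measure) \<longrightarrow>
              (\<exists>D \<in> sets cube_borel_measure. bkr_box r A \<subseteq> D \<and>
                emeasure cube_borel_measure D
                  \<le> (\<Prod>i\<in>{1..r}. emeasure cube_lebesgue_measure (A i))))"
proof -
  have r: "r \<ge> 1" using assms by simp
  have borel: "bkr_box r A \<in> sets cube_lebesgue_measure \<and>
      emeasure cube_lebesgue_measure (bkr_box r A) \<le> (\<Prod>i\<in>{1..r}. emeasure cube_borel_measure (A i))"
    if "\<forall>i\<in>{1..r}. A i \<in> sets cube_borel_measure" for A :: "nat \<Rightarrow> (real^'n) set"
    using that r bkr_box_measurable[of r A] bkr_box_borel[of r A] by (auto simp: sets_cube_borel_measure)
  have lebesgue: "\<exists>D \<in> sets cube_borel_measure. bkr_box r A \<subseteq> D \<and>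
      emeasure cube_borel_measure D \<le> (\<Prod>i\<in>{1..r}. emeasure cube_lebesgue_measure (A i))"
    if A: "\<forall>i\<in>{1..r}. A i \<in> sets cube_lebesgue_measure" for A :: "nat \<Rightarrow> (real^'n) set"
  proof -
    have hull: "\<exists>U. U \<in> sets cube_borel_measure \<and> S \<subseteq> U \<and>
        emeasure cube_borel_measure U = emeasure cube_lebesgue_measure S"
      if "S \<in> sets cube_lebesgue_measure" for S :: "(real^'n) set"
      using completion_inner_outer[OF that[unfolded cube_lebesgue_measure_def]]
      unfolding cube_lebesgue_measure_def by blast
    \<comment> \<open>Passing to Borel hulls enlarges the box but keeps the product of measures, so
      a hull of the larger box serves as \<open>D\<close>.\<close>
    have "\<forall>i\<in>{1..r}. \<exists>U. U \<in> sets cube_borel_measure \<and> A i \<subseteq> U \<and>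
        emeasure cube_borel_measure U = emeasure cube_lebesgue_measure (A i)"
      using A by (intro ballI hull) simp
    then obtain B where B: "\<And>i. i \<in> {1..r} \<Longrightarrow> B i \<in> sets cube_borel_measure"
      "\<And>i. i \<in> {1..r} \<Longrightarrow> A i \<subseteq> B i"
      "\<And>i. i \<in> {1..r} \<Longrightarrow> emeasure cube_borel_measure (B i) = emeasure cube_lebesgue_measure (A i)"
      by metis
    obtain D where D: "D \<in> sets cube_borel_measure" "bkr_box r B \<subseteq> D"
      "emeasure cube_borel_measure D = emeasure cube_lebesgue_measure (bkr_box r B)"
      using hull[of "bkr_box r B"] borel[of B] B(1) by blast
    have "bkr_box r A \<subseteq> D" using bkr_box_mono[of r A B] B(2) D(2) by blast
    moreover have "emeasure cube_borel_measure D \<le> (\<Prod>i\<in>{1..r}. emeasure cube_borel_measure (B i))"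
      using borel[of B] B(1) D(3) by simp
    ultimately show ?thesis using D(1) B(3) by auto
  qed
  show ?thesis
    by (intro conjI allI impI borel[THEN conjunct1] borel[THEN conjunct2] lebesgue)
qed

end
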